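(* Let $r\geq 1$ be an integer, let $k_1,\dots,k_r$ be formal variables, and set $K=\sum_{i=1}^r k_i$. For an unordered increasing tree $T$ with $r$ vertices, define its weight by \[ \mathrm{wt}(T) = \prod_{v=2}^r k_{f(v)} \left( \Big(\sum_{u \in \mathfrak{h}_T(v)} k_u \Big) - h_T(v) + 1 \right), \] where $f(v)$ is the father of $v$ in $T$, $\mathfrak{h}_T(v)$ is the hook of $v$ in $T$, and $h_T(v)=|\mathfrak{h}_T(v)|$. Then \[ \sum_T \mathrm{wt}(T) = k_1 \cdots k_r\, (K-1)_{r-2}, \] where the sum runs over all unordered increasing trees on $r$ vertices.
   Context: A rooted tree is a tree (acyclic connected graph) with a distinguished vertex, the root. Each edge joins a father (the endpoint closer to the root) to a son (the endpoint farther from the root). The descendants of a vertex are its sons and, recursively, the descendants of its sons. The hook $\mathfrak{h}_T(v)$ of a vertex $v$ in $T$ is the set consisting of $v$ and all its descendants, and $h_T(v)=|\mathfrak{h}_T(v)|$ is its size. An unordered increasing tree with $r$ vertices is a rooted tree whose vertices are labelled by $1,\dots,r$ (each label used exactly once; vertices are identified with their labels) such that the label of a son is always bigger than the label of its father (so the root has label $1$), and where the sons of a given vertex are not ordered. Thus such a tree is determined by its father function $f:\{2,\dots,r\}\to\{1,\dots,r\}$ with $f(v)<v$ for all $v$. Falling factorials: $(a)_m = a(a-1)\cdots(a-m+1)$ for positive integers $m$, $(a)_0=1$, and $(a)_m = 1/(a-m)_{-m}$ for negative integers $m$. An empty product is $1$. *)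

theory Defs
  imports
    "HOL-Library.Poly_Mapping"
    "HOL-Computational_Algebra.Fraction_Field"
begin

section \<open>Rooted trees\<close>

text \<open>Simple undirected graphs with a distinguished vertex; an edge is the set of its two endpoints.\<close>

record 'v rooted_graph =
  verts :: "'v set"
  edges :: "'v set set"
  root :: 'v

definition wf_graph :: "'v rooted_graph \<Rightarrow> bool" where
  "wf_graph G \<longleftrightarrow> root G \<in> verts G \<and> (\<forall>e\<in>edges G. e \<subseteq> verts G \<and> card e = 2)"

definition adj :: "'v rooted_graph \<Rightarrow> ('v \<times> 'v) set" where
  "adj G = {(u, v). {u, v} \<in> edges G}"

definition connected_graph :: "'v rooted_graph \<Rightarrow> bool" where
  "connected_graph G \<longleftrightarrow> (\<forall>u\<in>verts G. \<forall>v\<in>verts G. (u, v) \<in> (adj G)\<^sup>*)"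

definition is_cycle :: "'v rooted_graph \<Rightarrow> 'v list \<Rightarrow> bool" where
  "is_cycle G vs \<longleftrightarrow> length vs \<ge> 3 \<and> distinct vs \<and>
     (\<forall>i<length vs. {vs ! i, vs ! (Suc i mod length vs)} \<in> edges G)"

definition rooted_tree :: "'v rooted_graph \<Rightarrow> bool" where
  "rooted_tree G \<longleftrightarrow> wf_graph G \<and> connected_graph G \<and> \<not> (\<exists>vs. is_cycle G vs)"

definition root_dist :: "'v rooted_graph \<Rightarrow> 'v \<Rightarrow> nat" where
  "root_dist G v = (LEAST n. (root G, v) \<in> adj G ^^ n)"

text \<open>The pairs \<open>(u, v)\<close> such that \<open>u\<close> is the father of \<open>v\<close>, i.e. \<open>v\<close> is a son of \<open>u\<close>.\<close>

definition son_rel :: "'v rooted_graph \<Rightarrow> ('v \<times> 'v) set" where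
  "son_rel G = {(u, v). {u, v} \<in> edges G \<and> root_dist G u < root_dist G v}"

text \<open>In a rooted tree every vertex except the root has exactly one father;
  elsewhere the value is unspecified.\<close>

definition father :: "'v rooted_graph \<Rightarrow> 'v \<Rightarrow> 'v" where
  "father G v = (THE u. (u, v) \<in> son_rel G)"

definition descendants :: "'v rooted_graph \<Rightarrow> 'v \<Rightarrow> 'v set" where
  "descendants G v = {w. (v, w) \<in> (son_rel G)\<^sup>+}"

definition hook :: "'v rooted_graph \<Rightarrow> 'v \<Rightarrow> 'v set" where
  "hook G v = insert v (descendants G v)"

definition increasing_trees :: "nat \<Rightarrow> nat rooted_graph set" where
  "increasing_trees r = {T. rooted_tree T \<and> verts T = {1..r} \<and> (\<forall>(u, v)\<in>son_rel T. u < v)}"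

definition wt :: "nat \<Rightarrow> (nat \<Rightarrow> 'b::comm_ring_1) \<Rightarrow> nat rooted_graph \<Rightarrow> 'b" where
  "wt r k T = (\<Prod>v=2..r. k (father T v) *
     ((\<Sum>u\<in>hook T v. k u) - of_nat (card (hook T v)) + 1))"


section \<open>Falling factorials and formal variables\<close>

definition ffact_nat :: "'b::comm_ring_1 \<Rightarrow> nat \<Rightarrow> 'b" where
  "ffact_nat a m = (\<Prod>i<m. a - of_nat i)"

definition ffact :: "'b::field \<Rightarrow> int \<Rightarrow> 'b" where
  "ffact a m = (if m \<ge> 0 then ffact_nat a (nat m) else 1 / ffact_nat (a - of_int m) (nat (- m)))"

text \<open>A monomial is a finitely supported exponent function \<open>nat \<Rightarrow>\<^sub>0 nat\<close>, a polynomial in the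
  variables indexed by \<open>nat\<close> is a finitely supported coefficient function on monomials, and
  falling factorials of negative order live in the field of fractions.\<close>

type_synonym 'a ratfun = "((nat \<Rightarrow>\<^sub>0 nat) \<Rightarrow>\<^sub>0 'a) fract"

definition fvar :: "nat \<Rightarrow> 'a::idom ratfun" where
  "fvar i = Fract (Poly_Mapping.single (Poly_Mapping.single i 1) 1) 1"

end

theory Submission
  imports Defs "HOL-Library.FuncSet"
begin

text \<open>Increasing trees correspond to father functions \<open>f\<close> with \<open>f v < v\<close>. Contract the vertices
  \<open>1, \<dots>, j\<close> to one root of weight \<open>s\<^sub>j = k\<^sub>1 + \<dots> + k\<^sub>j\<close> and let \<open>W\<^sub>j\<close> be the weighted sum over the
  resulting forests, so that \<open>W\<^sub>1\<close> is the required sum and \<open>W\<^sub>r = 1\<close>. To compare \<open>W\<^sub>j\<close> with \<open>W\<^sub>m\<close> for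
  \<open>m = j + 1\<close>, the factor of the vertex \<open>m\<close> is \<open>k\<^sub>m\<close> plus the sum of \<open>Y\<^sub>c\<close> over its sons \<open>c\<close>, where \<open>Y\<^sub>c\<close> sums
  \<open>k\<^sub>u - 1\<close> over the hook of \<open>c\<close>. A vertex \<open>c\<close> with \<open>f c \<le> m\<close> may have any of \<open>1, \<dots>, m\<close> as its father
  without affecting the hooks above \<open>m\<close>, so the condition \<open>f c = m\<close> costs a factor \<open>k\<^sub>m / s\<^sub>m\<close>, while
  the sum of \<open>Y\<^sub>c\<close> over all \<open>c\<close> with \<open>f c \<le> m\<close> does not depend on \<open>f\<close>. Hence
  \<open>s\<^sub>m W\<^sub>j = s\<^sub>j k\<^sub>m (s\<^sub>r - (r - m)) W\<^sub>m\<close>, and the product of these relations telescopes.\<close>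

section \<open>Weighted sums over father functions\<close>

text \<open>With sons \<open>c > v\<close> this is the sum of \<open>y\<close> over the hook of
  \<open>v\<close>. Recursing on \<open>f\<close> alone keeps graphs out of the computation and
  makes sense for every \<open>f\<close>.\<close>

function hook_sum :: "nat \<Rightarrow> (nat \<Rightarrow> 'b::comm_monoid_add) \<Rightarrow> (nat \<Rightarrow> nat) \<Rightarrow> nat \<Rightarrow> 'b" where
  "hook_sum r y f v = y v + (\<Sum>c\<in>{c \<in> {v<..r}. f c = v}. hook_sum r y f c)"
  by pat_completeness auto
termination by (relation "measure (\<lambda>(r, y, f, v). r - v)") auto

declare hook_sum.simps [simp del]

text \<open>The recursion only asks which \<open>f c\<close> equal a given vertex
  \<open>u \<ge> v\<close>, so fathers smaller than \<open>v\<close> may be exchanged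
  freely.\<close>

lemma hook_sum_cong:
  assumes "\<And>c u. v < c \<Longrightarrow> c \<le> r \<Longrightarrow> v \<le> u \<Longrightarrow> f c = u \<longleftrightarrow> g c = u"
  shows "hook_sum r y f v = hook_sum r y g v"
  using assms
proof (induction r y f v rule: hook_sum.induct)
  case (1 r y f v)
  have eq: "{c \<in> {v<..r}. f c = v} = {c \<in> {v<..r}. g c = v}"
    using 1(2) by auto
  have "hook_sum r y f c = hook_sum r y g c" if "c \<in> {c \<in> {v<..r}. f c = v}" for c
    using that 1(2) by (intro 1(1)) auto
  then show ?case
    unfolding hook_sum.simps[of r y f v] hook_sum.simps[of r y g v] eq
    by (intro arg_cong2[of _ _ _ _ "(+)"] sum.cong) (auto simp: eq)
qed

text \<open>The vertices \<open>c > m\<close> with \<open>f c \<le> m\<close> are the tops of the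
  forest on \<open>{m<..r}\<close>, and their hooks partition it. Lowering \<open>m\<close> by one
  adds a top that absorbs the hooks of its sons.\<close>

lemma sum_hook_sum_top:
  fixes y :: "nat \<Rightarrow> 'b::comm_ring_1"
  assumes "m \<le> r" "\<And>c. m < c \<Longrightarrow> c \<le> r \<Longrightarrow> f c < c"
  shows "(\<Sum>c\<in>{c \<in> {m<..r}. f c \<le> m}. hook_sum r y f c) = (\<Sum>w\<in>{m<..r}. y w)"
  using assms
proof (induction "r - m" arbitrary: m)
  case 0
  then show ?case by simp
next
  case (Suc n)
  let ?h = "hook_sum r y f" and ?M = "Suc m"
  have ins: "{m<..r} = insert ?M {?M<..r}" using Suc by auto
  have IH: "(\<Sum>c\<in>{c \<in> {?M<..r}. f c \<le> ?M}. ?h c) = (\<Sum>w\<in>{?M<..r}. y w)"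
    using Suc by (intro Suc(1)) auto
  \<comment> \<open>\<open>Suc m\<close> is a top because its father is smaller than it.\<close>
  have 1: "{c \<in> {m<..r}. f c \<le> m} = insert ?M {c \<in> {?M<..r}. f c \<le> m}"
    using Suc.prems(2)[of ?M] Suc.hyps(2) by (auto simp: less_Suc_eq_le)
  have 2: "{c \<in> {?M<..r}. f c \<le> ?M} = {c \<in> {?M<..r}. f c = ?M} \<union> {c \<in> {?M<..r}. f c \<le> m}"
    by auto
  have "(\<Sum>c\<in>{c \<in> {m<..r}. f c \<le> m}. ?h c) = ?h ?M + (\<Sum>c\<in>{c \<in> {?M<..r}. f c \<le> m}. ?h c)"
    unfolding 1 by (subst sum.insert) auto
  also have "\<dots> = y ?M + ((\<Sum>c\<in>{c \<in> {?M<..r}. f c = ?M}. ?h c) + (\<Sum>c\<in>{c \<in> {?M<..r}. f c \<le> m}. ?h c))"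
    by (subst hook_sum.simps) (simp add: add.assoc)
  also have "\<dots> = y ?M + (\<Sum>c\<in>{c \<in> {?M<..r}. f c \<le> ?M}. ?h c)"
    unfolding 2 by (subst sum.union_disjoint) auto
  also have "\<dots> = (\<Sum>w\<in>{m<..r}. y w)"
    unfolding IH ins by simp
  finally show ?case .
qed

section \<open>Forests and the recursion for their weighted sums\<close>

lemma sum_PiE_insert:
  assumes "x \<notin> S"
  shows "(\<Sum>f\<in>PiE (insert x S) B. G f) = (\<Sum>g\<in>PiE S B. \<Sum>a\<in>B x. G (g(x := a)))"
proof -
  have "(\<Sum>f\<in>PiE (insert x S) B. G f) = (\<Sum>(a, g)\<in>B x \<times> PiE S B. G (g(x := a)))"
    unfolding PiE_insert_eq
    by (subst sum.reindex[OF inj_combinator[OF assms]]) (auto intro!: sum.cong)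
  also have "\<dots> = (\<Sum>a\<in>B x. \<Sum>g\<in>PiE S B. G (g(x := a)))"
    by (rule sum.cartesian_product[symmetric])
  finally show ?thesis by (subst sum.swap) 
qed

text \<open>The vertices \<open>1, \<dots>, j\<close> are the roots of a forest, i.e. the result of contracting them to a
  single root; only the fathers of the larger vertices are recorded.\<close>

definition forests :: "nat \<Rightarrow> nat \<Rightarrow> (nat \<Rightarrow> nat) set" where
  "forests r j = PiE {j<..r} (\<lambda>v. {1..<v})"

definition forest_weight :: "nat \<Rightarrow> (nat \<Rightarrow> 'b::comm_ring_1) \<Rightarrow> nat \<Rightarrow> (nat \<Rightarrow> nat) \<Rightarrow> 'b" where
  "forest_weight r k j f = (\<Prod>v\<in>{j<..r}. k (f v) * (hook_sum r (\<lambda>u. k u - 1) f v + 1))"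

text \<open>Moving \<open>c\<close> to another father \<open>a \<le> m\<close> changes no hook of a
  vertex above \<open>m\<close>, so the summand depends on \<open>a\<close> only through the factor
  \<open>k a\<close>. The case \<open>a = m\<close> is compared with all \<open>a \<le> m\<close>;
  the proportion is written without division because the weights lie in a ring.\<close>

lemma sum_forest_weight_resample:
  fixes k :: "nat \<Rightarrow> 'b::comm_ring_1"
  assumes m: "1 \<le> m" and c: "c \<in> {m<..r}"
  defines "H \<equiv> hook_sum r (\<lambda>u. k u - 1)"
  shows "(\<Sum>i=1..m. k i) * (\<Sum>g\<in>forests r m. if g c = m then H g c * forest_weight r k m g else 0)
    = k m * (\<Sum>g\<in>forests r m. if g c \<le> m then H g c * forest_weight r k m g else 0)"
proof -
  let ?S = "{m<..r} - {c}" and ?B = "\<lambda>v::nat. {1..<v}"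
  \<comment> \<open>\<open>Q\<close> is the summand without the factor \<open>k (g c)\<close>. It is
    evaluated with the father of \<open>c\<close> reset to \<open>1\<close>, which represents all
    choices \<open>a \<le> m\<close>.\<close>
  define Q where "Q h = H h c * (\<Prod>v\<in>?S. k (h v) * (H h v + 1)) * (H h c + 1)" for h
  have ins: "{m<..r} = insert c ?S" using c by auto
  have term_eq: "H (h(c := a)) c * forest_weight r k m (h(c := a)) = k a * Q (h(c := 1))"
    if "a \<le> m" for a h
  proof -
    have H: "H (h(c := a)) v = H (h(c := 1)) v" if "m < v" for v
      unfolding H_def using that \<open>a \<le> m\<close> m by (intro hook_sum_cong) auto
    have "forest_weight r k m (h(c := a)) = k a * (H (h(c := a)) c + 1) *
        (\<Prod>v\<in>?S. k ((h(c := a)) v) * (H (h(c := a)) v + 1))"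
      unfolding forest_weight_def H_def[symmetric] by (subst ins, subst prod.insert) auto
    also have "(\<Prod>v\<in>?S. k ((h(c := a)) v) * (H (h(c := a)) v + 1)) =
        (\<Prod>v\<in>?S. k ((h(c := 1)) v) * (H (h(c := 1)) v + 1))"
      using H by (intro prod.cong) auto
    finally show ?thesis
      using H[of c] c unfolding Q_def by (simp add: mult_ac del: fun_upd_apply)
  qed
  have split: "(\<Sum>g\<in>forests r m. G g) = (\<Sum>h\<in>PiE ?S ?B. \<Sum>a\<in>?B c. G (h(c := a)))"
    for G :: "(nat \<Rightarrow> nat) \<Rightarrow> 'b"
    unfolding forests_def by (subst ins, rule sum_PiE_insert) auto
  have L: "(\<Sum>g\<in>forests r m. if g c = m then H g c * forest_weight r k m g else 0)
      = (\<Sum>h\<in>PiE ?S ?B. k m * Q (h(c := 1)))"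
    unfolding split
  proof (rule sum.cong)
    fix h
    have "(\<Sum>a\<in>?B c. if (h(c := a)) c = m then H (h(c := a)) c * forest_weight r k m (h(c := a)) else 0)
      = (\<Sum>a\<in>?B c. if a = m then k m * Q (h(c := 1)) else 0)"
      using term_eq by (intro sum.cong) auto
    also have "\<dots> = k m * Q (h(c := 1))" using c m by simp
    finally show "(\<Sum>a\<in>?B c. if (h(c := a)) c = m then H (h(c := a)) c * forest_weight r k m (h(c := a)) else 0)
      = k m * Q (h(c := 1))" .
  qed simp
  have R: "(\<Sum>g\<in>forests r m. if g c \<le> m then H g c * forest_weight r k m g else 0)
      = (\<Sum>h\<in>PiE ?S ?B. (\<Sum>i=1..m. k i) * Q (h(c := 1)))"
    unfolding split
  proof (rule sum.cong)
    fix h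
    have "(\<Sum>a\<in>?B c. if (h(c := a)) c \<le> m then H (h(c := a)) c * forest_weight r k m (h(c := a)) else 0)
      = (\<Sum>a\<in>?B c. if a \<le> m then k a * Q (h(c := 1)) else 0)"
      using term_eq by (intro sum.cong) auto
    \<comment> \<open>By \<open>m < c\<close> all of \<open>{1..m}\<close> are admissible fathers of
      \<open>c\<close>.\<close>
    also have "\<dots> = (\<Sum>a=1..m. k a * Q (h(c := 1)))"
      using c by (intro sum.mono_neutral_cong_right) auto
    finally show "(\<Sum>a\<in>?B c. if (h(c := a)) c \<le> m then H (h(c := a)) c * forest_weight r k m (h(c := a)) else 0)
      = (\<Sum>i=1..m. k i) * Q (h(c := 1))" by (simp add: sum_distrib_right)
  qed simp
  show ?thesis
    unfolding L R by (simp add: sum_distrib_left mult_ac)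
qed

text \<open>Summing over the father of \<open>Suc j\<close> yields the partial sum up to
  \<open>j\<close>; expanding its hook factor over its sons and resampling the father of each
  possible son yields the rest.\<close>

lemma sum_forest_weight_step:
  fixes k :: "nat \<Rightarrow> 'b::comm_ring_1"
  assumes j: "1 \<le> j" "j < r"
  shows "(\<Sum>i=1..Suc j. k i) * (\<Sum>f\<in>forests r j. forest_weight r k j f)
    = (\<Sum>i=1..j. k i) * k (Suc j) * ((\<Sum>i=1..r. k i) - of_nat (r - Suc j)) *
      (\<Sum>f\<in>forests r (Suc j). forest_weight r k (Suc j) f)"
proof -
  let ?m = "Suc j" and ?y = "\<lambda>u. k u - 1"
  let ?H = "hook_sum r ?y" and ?w = "forest_weight r k (Suc j)"
  let ?s = "\<lambda>m. \<Sum>i=1..m. k i"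
  have ins: "{j<..r} = insert ?m {?m<..r}" using j by auto
  \<comment> \<open>The \<open>+ 1\<close> cancels the \<open>- 1\<close> in \<open>?y ?m\<close>,
    leaving \<open>k ?m\<close> and the hook sums of the sons.\<close>
  have hs: "?H g ?m + 1 = k ?m + (\<Sum>c\<in>{?m<..r}. if g c = ?m then ?H g c else 0)" for g
    by (subst hook_sum.simps, subst sum.inter_filter) simp_all
  have weight: "forest_weight r k j (g(?m := a)) = k a * ((?H g ?m + 1) * ?w g)" for g a
  proof -
    \<comment> \<open>Hooks of vertices from \<open>?m\<close> upward do not involve the father of
      \<open>?m\<close>.\<close>
    have H: "?H (g(?m := a)) v = ?H g v" if "?m \<le> v" for v
      using that by (intro hook_sum_cong) auto
    have "forest_weight r k j (g(?m := a)) = k a * (?H g ?m + 1) *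
        (\<Prod>v\<in>{?m<..r}. k ((g(?m := a)) v) * (?H (g(?m := a)) v + 1))"
      unfolding forest_weight_def ins by (subst prod.insert) (auto simp: H)
    also have "(\<Prod>v\<in>{?m<..r}. k ((g(?m := a)) v) * (?H (g(?m := a)) v + 1)) = ?w g"
      unfolding forest_weight_def using H by (intro prod.cong) auto
    finally show ?thesis by (simp only: mult_ac)
  qed
  have "(\<Sum>f\<in>forests r j. forest_weight r k j f)
      = (\<Sum>g\<in>forests r ?m. \<Sum>a\<in>{1..<?m}. forest_weight r k j (g(?m := a)))"
    unfolding forests_def ins by (rule sum_PiE_insert) auto
  also have "\<dots> = (\<Sum>g\<in>forests r ?m. ?s j * ((?H g ?m + 1) * ?w g))"
    unfolding weight by (simp add: sum_distrib_right atLeastLessThanSuc_atLeastAtMost)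
  also have "\<dots> = ?s j * (\<Sum>g\<in>forests r ?m. k ?m * ?w g +
      (\<Sum>c\<in>{?m<..r}. if g c = ?m then ?H g c * ?w g else 0))"
    unfolding hs
    by (auto simp: sum_distrib_left sum_distrib_right algebra_simps intro!: sum.cong)
  also have "\<dots> = ?s j * (k ?m * (\<Sum>g\<in>forests r ?m. ?w g) +
      (\<Sum>c\<in>{?m<..r}. \<Sum>g\<in>forests r ?m. if g c = ?m then ?H g c * ?w g else 0))"
    by (subst sum.swap) (simp add: sum.distrib sum_distrib_left)
  finally have W: "(\<Sum>f\<in>forests r j. forest_weight r k j f) = \<dots>" .
  have "?s ?m * (\<Sum>c\<in>{?m<..r}. \<Sum>g\<in>forests r ?m. if g c = ?m then ?H g c * ?w g else 0)
      = (\<Sum>c\<in>{?m<..r}. ?s ?m * (\<Sum>g\<in>forests r ?m. if g c = ?m then ?H g c * ?w g else 0))"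
    by (rule sum_distrib_left)
  also have "\<dots> = (\<Sum>c\<in>{?m<..r}. k ?m * (\<Sum>g\<in>forests r ?m. if g c \<le> ?m then ?H g c * ?w g else 0))"
    by (intro sum.cong refl sum_forest_weight_resample) auto
  also have "\<dots> = k ?m * (\<Sum>g\<in>forests r ?m. \<Sum>c\<in>{?m<..r}. if g c \<le> ?m then ?H g c * ?w g else 0)"
    by (subst sum.swap) (simp add: sum_distrib_left)
  \<comment> \<open>For each \<open>g\<close> the hooks of the tops exhaust \<open>{?m<..r}\<close>,
    so the inner sum is a constant times the weight.\<close>
  also have "(\<Sum>g\<in>forests r ?m. \<Sum>c\<in>{?m<..r}. if g c \<le> ?m then ?H g c * ?w g else 0)
      = (\<Sum>g\<in>forests r ?m. (\<Sum>w\<in>{?m<..r}. ?y w) * ?w g)"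
  proof (rule sum.cong[OF refl])
    fix g assume g: "g \<in> forests r ?m"
    have "(\<Sum>c\<in>{?m<..r}. if g c \<le> ?m then ?H g c * ?w g else 0)
        = (\<Sum>c\<in>{c \<in> {?m<..r}. g c \<le> ?m}. ?H g c) * ?w g"
      by (subst sum.inter_filter) (auto simp: sum_distrib_right intro!: sum.cong)
    also have "(\<Sum>c\<in>{c \<in> {?m<..r}. g c \<le> ?m}. ?H g c) = (\<Sum>w\<in>{?m<..r}. ?y w)"
      using g j by (intro sum_hook_sum_top) (auto simp: forests_def PiE_def Pi_def)
    finally show "(\<Sum>c\<in>{?m<..r}. if g c \<le> ?m then ?H g c * ?w g else 0) = (\<Sum>w\<in>{?m<..r}. ?y w) * ?w g" .
  qed
  finally have R: "?s ?m * (\<Sum>c\<in>{?m<..r}. \<Sum>g\<in>forests r ?m. if g c = ?m then ?H g c * ?w g else 0)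
      = k ?m * (\<Sum>w\<in>{?m<..r}. ?y w) * (\<Sum>g\<in>forests r ?m. ?w g)"
    by (simp only: sum_distrib_left[symmetric] mult.assoc)
  have "?s r = sum k ({1..?m} \<union> {?m<..r})"
    using j by (intro sum.cong) auto
  also have "\<dots> = ?s ?m + sum k {?m<..r}"
    by (rule sum.union_disjoint) auto
  finally have s: "?s ?m + (\<Sum>w\<in>{?m<..r}. ?y w) = ?s r - of_nat (r - ?m)"
    by (simp add: sum_subtractf)
  have "?s ?m * (\<Sum>f\<in>forests r j. forest_weight r k j f)
      = ?s j * (k ?m * ?s ?m * (\<Sum>g\<in>forests r ?m. ?w g) +
      ?s ?m * (\<Sum>c\<in>{?m<..r}. \<Sum>g\<in>forests r ?m. if g c = ?m then ?H g c * ?w g else 0))"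
    unfolding W by (simp only: algebra_simps)
  also have "\<dots> = ?s j * k ?m * (?s ?m + (\<Sum>w\<in>{?m<..r}. ?y w)) * (\<Sum>g\<in>forests r ?m. ?w g)"
    unfolding R by (simp only: algebra_simps)
  finally show ?thesis unfolding s .
qed

text \<open>Downward induction from \<open>j = r\<close>, where the only forest is empty and has
  weight \<open>1\<close>. Nonzero partial sums allow cancelling the factor
  \<open>\<Sum>i=1..Suc j. k i\<close> that each step brings in.\<close>

lemma sum_forest_weight:
  fixes k :: "nat \<Rightarrow> 'b::idom"
  assumes "1 \<le> j" "j \<le> r" and nz: "\<And>m. 1 \<le> m \<Longrightarrow> m \<le> r \<Longrightarrow> (\<Sum>i=1..m. k i) \<noteq> 0"
  shows "(\<Sum>i=1..r. k i) * (\<Sum>f\<in>forests r j. forest_weight r k j f)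
    = (\<Sum>i=1..j. k i) * (\<Prod>i\<in>{j<..r}. k i) * ffact_nat (\<Sum>i=1..r. k i) (r - j)"
  using assms(2,1)
proof (induction j rule: inc_induct)
  case base
  then show ?case by (simp add: forests_def forest_weight_def ffact_nat_def)
next
  case (step j)
  let ?s = "\<lambda>m. \<Sum>i=1..m. k i"
  let ?W = "\<lambda>j. \<Sum>f\<in>forests r j. forest_weight r k j f"
  have ins: "{j<..r} = insert (Suc j) {Suc j<..r}" using step by auto
  have rj: "r - j = Suc (r - Suc j)" using step by auto
  have IH: "?s r * ?W (Suc j) =
      ?s (Suc j) * (\<Prod>i\<in>{Suc j<..r}. k i) * ffact_nat (?s r) (r - Suc j)"
    by (rule step.IH) simp
  have "?s (Suc j) * (?s r * ?W j) = ?s r * (?s (Suc j) * ?W j)" by (rule mult.left_commute)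
  also have "\<dots> = ?s j * k (Suc j) * (?s r - of_nat (r - Suc j)) * (?s r * ?W (Suc j))"
    unfolding sum_forest_weight_step[OF step.prems step.hyps(2)] by (simp only: mult_ac)
  \<comment> \<open>The new factor \<open>?s r - of_nat (r - Suc j)\<close> is the last one of the
    falling factorial of order \<open>r - j\<close>.\<close>
  also have "\<dots> = ?s (Suc j) * (?s j * (\<Prod>i\<in>{j<..r}. k i) * ffact_nat (?s r) (r - j))"
    unfolding IH ins rj ffact_nat_def by (simp add: mult_ac del: sum.cl_ivl_Suc)
  finally show ?case
    using nz[of "Suc j"] step by (simp del: sum.cl_ivl_Suc)
qed

section \<open>Increasing trees as father functions\<close>

text \<open>Cycles are lists of distinct vertices, so walks have to be shortened to paths: extend
  edge by edge, and when the new vertex already lies on the path, cut the path there.\<close>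

lemma rtrancl_imp_distinct_path:
  assumes "(a, b) \<in> R\<^sup>*"
  shows "\<exists>xs. xs \<noteq> [] \<and> hd xs = a \<and> last xs = b \<and> distinct xs \<and>
    (\<forall>i. Suc i < length xs \<longrightarrow> (xs ! i, xs ! Suc i) \<in> R)"
  using assms
proof (induction rule: rtrancl_induct)
  case base
  show ?case by (intro exI[of _ "[a]"]) auto
next
  case (step y z)
  then obtain xs where xs: "xs \<noteq> []" "hd xs = a" "last xs = y" "distinct xs"
      "\<And>i. Suc i < length xs \<Longrightarrow> (xs ! i, xs ! Suc i) \<in> R" by blast
  show ?case
  proof (cases "z \<in> set xs")
    case True
    then obtain i where i: "i < length xs" "xs ! i = z" by (auto simp: in_set_conv_nth)
    have "last (take (Suc i) xs) = z" using i by (simp add: take_Suc_conv_app_nth)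
    then show ?thesis
      using xs i by (intro exI[of _ "take (Suc i) xs"]) auto
  next
    case False
    have "((xs @ [z]) ! i, (xs @ [z]) ! Suc i) \<in> R" if "Suc i < length (xs @ [z])" for i
    proof (cases "Suc i = length xs")
      case True
      then have "xs ! i = y" using xs(1,3) by (metis last_conv_nth diff_Suc_1)
      then show ?thesis using True step(2) by (auto simp: nth_append)
    next
      case False
      then show ?thesis using xs(5)[of i] that by (auto simp: nth_append)
    qed
    then show ?thesis
      using xs False by (intro exI[of _ "xs @ [z]"]) auto
  qed
qed

lemma adj_sym: "(u, v) \<in> adj G \<longleftrightarrow> (v, u) \<in> adj G"
  by (simp add: adj_def insert_commute)

lemma root_dist_le: "(root G, v) \<in> adj G ^^ n \<Longrightarrow> root_dist G v \<le> n"
  unfolding root_dist_def by (rule Least_le)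

text \<open>A father is the last vertex before \<open>v\<close> on a shortest walk from the
  root.\<close>

lemma exists_son_rel_pred:
  assumes G: "wf_graph G" "connected_graph G" and v: "v \<in> verts G" "v \<noteq> root G"
  shows "\<exists>u. (u, v) \<in> son_rel G"
proof -
  have "(root G, v) \<in> (adj G)\<^sup>*"
    using G v unfolding wf_graph_def connected_graph_def by blast
  then obtain n where "(root G, v) \<in> adj G ^^ n" by (auto simp: rtrancl_power)
  then have d: "(root G, v) \<in> adj G ^^ root_dist G v"
    unfolding root_dist_def by (rule LeastI)
  with v(2) obtain m where m: "root_dist G v = Suc m"
    by (cases "root_dist G v") auto
  with d obtain u where u: "(root G, u) \<in> adj G ^^ m" "(u, v) \<in> adj G" by auto
  then have "root_dist G u < root_dist G v" using root_dist_le[OF u(1)] m by simp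
  with u(2) show ?thesis by (auto simp: son_rel_def adj_def)
qed

section \<open>The tree of a father function\<close>

definition father_graph :: "nat \<Rightarrow> (nat \<Rightarrow> nat) \<Rightarrow> nat rooted_graph" where
  "father_graph r f = \<lparr>verts = {1..r}, edges = (\<lambda>v. {f v, v}) ` {1<..r}, root = 1\<rparr>"

lemma father_graph_simps [simp]:
  "verts (father_graph r f) = {1..r}"
  "edges (father_graph r f) = (\<lambda>v. {f v, v}) ` {1<..r}"
  "root (father_graph r f) = 1"
  by (simp_all add: father_graph_def)

context
  fixes r :: nat and f :: "nat \<Rightarrow> nat"
  assumes r: "1 \<le> r" and f: "\<And>v. v \<in> {1<..r} \<Longrightarrow> 1 \<le> f v \<and> f v < v"
begin

lemma adj_father_graph:
  "(u, v) \<in> adj (father_graph r f) \<longleftrightarrow>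
    (v \<in> {1<..r} \<and> u = f v) \<or> (u \<in> {1<..r} \<and> v = f u)"
  by (auto simp: adj_def doubleton_eq_iff)

lemma edge_father_graph_less:
  assumes "{a, b} \<in> edges (father_graph r f)" "a < b"
  shows "b \<in> {1<..r} \<and> a = f b"
  using assms f by (auto simp: doubleton_eq_iff) (metis less_asym greaterThanAtMost_iff)+

lemma root_rtrancl_father_graph:
  assumes "v \<in> {1..r}"
  shows "(1, v) \<in> (adj (father_graph r f))\<^sup>*"
  using assms
proof (induction v rule: less_induct)
  case (less v)
  show ?case
  proof (cases "v = 1")
    case False
    with less.prems have v: "v \<in> {1<..r}" by auto
    then have "(1, f v) \<in> (adj (father_graph r f))\<^sup>*" using f[OF v] by (intro less.IH) auto
    moreover have "(f v, v) \<in> adj (father_graph r f)" using v by (simp add: adj_father_graph)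
    ultimately show ?thesis by (rule rtrancl_into_rtrancl)
  qed simp
qed

text \<open>The largest vertex of a cycle would have two different smaller neighbours, whereas its
  only smaller neighbour is its value under \<open>f\<close>.\<close>

lemma acyclic_father_graph: "\<not> is_cycle (father_graph r f) vs"
proof
  let ?E = "edges (father_graph r f)" and ?n = "length vs"
  assume cyc: "is_cycle (father_graph r f) vs"
  then have n: "?n \<ge> 3" and dist: "distinct vs"
    and e: "\<And>i. i < ?n \<Longrightarrow> {vs ! i, vs ! (Suc i mod ?n)} \<in> ?E"
    by (auto simp: is_cycle_def)
  have "Max (set vs) \<in> set vs" using n by (intro Max_in) auto
  then obtain i where i: "i < ?n" "vs ! i = Max (set vs)" by (auto simp: in_set_conv_nth)
  \<comment> \<open>\<open>p\<close> and \<open>s\<close> are the positions cyclically before and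
    after \<open>i\<close>; they differ because the length is at least \<open>3\<close>.\<close>
  define p where "p = (if i = 0 then ?n - 1 else i - 1)"
  define s where "s = Suc i mod ?n"
  have p: "p < ?n" "Suc p mod ?n = i" "p \<noteq> i" using n i by (auto simp: p_def)
  have s: "s < ?n" "s \<noteq> i" "p \<noteq> s"
    using n i by (auto simp: p_def s_def mod_Suc split: if_splits)
  have less: "vs ! j < vs ! i" if "j < ?n" "j \<noteq> i" for j
  proof -
    have "vs ! j \<le> vs ! i" using that i by (auto intro: Max_ge)
    moreover have "vs ! j \<noteq> vs ! i" using that i(1) dist by (simp add: nth_eq_iff_index_eq)
    ultimately show ?thesis by simp
  qed
  have "vs ! p = f (vs ! i)"
    using e[OF p(1)] less[OF p(1,3)] unfolding p(2) by (rule edge_father_graph_less[THEN conjunct2])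
  moreover have "vs ! s = f (vs ! i)"
    using e[OF i(1)] less[OF s(1,2)] unfolding s_def[symmetric]
    by (subst (asm) insert_commute) (rule edge_father_graph_less[THEN conjunct2])
  ultimately show False
    using nth_eq_iff_index_eq[OF dist p(1) s(1)] s(3) by simp
qed

lemma rooted_tree_father_graph: "rooted_tree (father_graph r f)"
proof -
  let ?G = "father_graph r f"
  have "e \<subseteq> verts ?G \<and> card e = 2" if "e \<in> edges ?G" for e
  proof -
    from that obtain v where "v \<in> {1<..r}" "e = {f v, v}" by auto
    then show ?thesis using f[of v] by (auto simp: card_2_iff)
  qed
  then have wf: "wf_graph ?G" using r by (simp add: wf_graph_def)
  have "sym (adj ?G)" by (rule symI) (simp only: adj_sym)
  then have "sym ((adj ?G)\<^sup>*)" by (rule sym_rtrancl)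
  then have "connected_graph ?G"
    unfolding connected_graph_def using root_rtrancl_father_graph
    by (metis father_graph_simps(1) rtrancl_trans symE)
  with wf acyclic_father_graph show ?thesis by (simp add: rooted_tree_def)
qed


text \<open>Induction from large labels down: some \<open>u\<close> precedes \<open>v\<close> in
  \<open>son_rel\<close>. If \<open>u\<close> is not \<open>f v\<close>, then
  \<open>v = f u < u\<close>, and the induction hypothesis puts \<open>v\<close> closer to the root
  than \<open>u\<close>, a contradiction.\<close>

lemma father_son_rel:
  assumes "v \<in> {1<..r}"
  shows "(f v, v) \<in> son_rel (father_graph r f)"
  using assms
proof (induction "r - v" arbitrary: v rule: less_induct)
  case less
  let ?G = "father_graph r f"
  have "v \<in> verts ?G" "v \<noteq> root ?G" using less.prems by auto
  then obtain u where u: "(u, v) \<in> son_rel ?G"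
    using exists_son_rel_pred rooted_tree_father_graph unfolding rooted_tree_def by metis
  then have "(u, v) \<in> adj ?G" by (simp add: son_rel_def adj_def)
  then show ?case
    unfolding adj_father_graph
  proof
    assume "v \<in> {1<..r} \<and> u = f v"
    then show ?thesis using u by simp
  next
    assume u': "u \<in> {1<..r} \<and> v = f u"
    then have "(f u, u) \<in> son_rel ?G" using f[of u] by (intro less.hyps) auto
    then show ?thesis using u u' by (simp add: son_rel_def)
  qed
qed

lemma son_rel_father_graph:
  "(u, v) \<in> son_rel (father_graph r f) \<longleftrightarrow> v \<in> {1<..r} \<and> u = f v"
proof
  assume uv: "(u, v) \<in> son_rel (father_graph r f)"
  then have "(u, v) \<in> adj (father_graph r f)" by (simp add: son_rel_def adj_def)
  then show "v \<in> {1<..r} \<and> u = f v"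
    unfolding adj_father_graph using uv father_son_rel[of u] by (auto simp: son_rel_def)
qed (use father_son_rel in auto)

lemma father_father_graph:
  assumes "v \<in> {1<..r}"
  shows "father (father_graph r f) v = f v"
  unfolding father_def son_rel_father_graph using assms by auto

lemma father_graph_increasing: "father_graph r f \<in> increasing_trees r"
  using rooted_tree_father_graph f by (auto simp: increasing_trees_def son_rel_father_graph)

section \<open>Hooks in the tree of a father function\<close>

lemma son_rel_father_graph_rtrancl_le:
  assumes "(u, v) \<in> (son_rel (father_graph r f))\<^sup>*"
  shows "u \<le> v"
  using assms
proof (induction rule: rtrancl_induct)
  case (step v w)
  then show ?case using f[of w] by (auto simp: son_rel_father_graph)
qed simp

lemma hook_father_graph_rec:
  assumes "1 \<le> v"
  shows "hook (father_graph r f) v =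
    insert v (\<Union>c\<in>{c \<in> {v<..r}. f c = v}. hook (father_graph r f) c)"
proof -
  let ?R = "son_rel (father_graph r f)"
  have hook: "hook (father_graph r f) u = {w. (u, w) \<in> ?R\<^sup>*}" for u
    unfolding hook_def descendants_def by (auto simp: rtrancl_eq_or_trancl)
  have "(v, w) \<in> ?R\<^sup>+ \<longleftrightarrow> (\<exists>c\<in>{c \<in> {v<..r}. f c = v}. (c, w) \<in> ?R\<^sup>*)" for w
  proof
    assume "(v, w) \<in> ?R\<^sup>+"
    then obtain c where c: "(v, c) \<in> ?R" "(c, w) \<in> ?R\<^sup>*" by (meson tranclD)
    then show "\<exists>c\<in>{c \<in> {v<..r}. f c = v}. (c, w) \<in> ?R\<^sup>*"
      using f[of c] by (auto simp: son_rel_father_graph)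
  next
    assume "\<exists>c\<in>{c \<in> {v<..r}. f c = v}. (c, w) \<in> ?R\<^sup>*"
    then obtain c where c: "c \<in> {v<..r}" "f c = v" "(c, w) \<in> ?R\<^sup>*" by auto
    then have "(v, c) \<in> ?R" using assms by (simp add: son_rel_father_graph)
    then show "(v, w) \<in> ?R\<^sup>+" using c(3) by (rule rtrancl_into_trancl2)
  qed
  then show ?thesis unfolding hook[of c for c] hook_def descendants_def
    by (auto simp: rtrancl_eq_or_trancl)
qed

text \<open>Fathers are unique, so a common descendant would make one of \<open>c\<close>,
  \<open>c'\<close> a descendant of the other. The path between them would enter through the common
  father, which is smaller than its start, while labels grow along paths.\<close>

lemma hook_father_graph_disjoint:
  assumes "c \<in> {1<..r}" "c' \<in> {1<..r}" "c \<noteq> c'" "f c = f c'"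
  shows "hook (father_graph r f) c \<inter> hook (father_graph r f) c' = {}"
proof -
  let ?R = "son_rel (father_graph r f)"
  have hook: "hook (father_graph r f) u = {w. (u, w) \<in> ?R\<^sup>*}" for u
    unfolding hook_def descendants_def by (auto simp: rtrancl_eq_or_trancl)
  have sv: "single_valued (?R\<inverse>)"
    by (auto simp: single_valued_def son_rel_father_graph)
  have no_path: "(a, b) \<notin> ?R\<^sup>*" if "a \<in> {1<..r}" "b \<in> {1<..r}" "a \<noteq> b" "f a = f b" for a b
  proof
    assume "(a, b) \<in> ?R\<^sup>*"
    with \<open>a \<noteq> b\<close> obtain z where z: "(a, z) \<in> ?R\<^sup>*" "(z, b) \<in> ?R" by (auto elim: rtranclE)
    then have "a \<le> f a"
      using son_rel_father_graph_rtrancl_le[OF z(1)] that by (simp add: son_rel_father_graph)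
    then show False using f[OF that(1)] by simp
  qed
  have False if "(c, w) \<in> ?R\<^sup>*" "(c', w) \<in> ?R\<^sup>*" for w
  proof -
    have "(w, c) \<in> (?R\<inverse>)\<^sup>*" "(w, c') \<in> (?R\<inverse>)\<^sup>*" using that by (auto simp: rtrancl_converse)
    then have "(c, c') \<in> (?R\<inverse>)\<^sup>* \<or> (c', c) \<in> (?R\<inverse>)\<^sup>*" by (rule single_valued_confluent[OF sv])
    then show False
      using no_path[of c c'] no_path[of c' c] assms by (auto simp: rtrancl_converse)
  qed
  then show ?thesis unfolding hook by auto
qed

lemma finite_hook_father_graph:
  assumes "1 \<le> v"
  shows "finite (hook (father_graph r f) v)"
  using assms
proof (induction "r - v" arbitrary: v rule: less_induct)
  case less
  have "finite (hook (father_graph r f) c)" if "c \<in> {c \<in> {v<..r}. f c = v}" for c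
    using that less.prems by (intro less.hyps) auto
  then show ?case
    by (subst hook_father_graph_rec[OF less.prems]) simp
qed

text \<open>The hook of \<open>v\<close> consists of \<open>v\<close> and the disjoint hooks of its
  sons, which is the recursion of \<open>hook_sum\<close>.\<close>

lemma sum_hook_father_graph:
  assumes "1 \<le> v"
  shows "sum y (hook (father_graph r f) v) = hook_sum r y f v"
  using assms
proof (induction "r - v" arbitrary: v rule: less_induct)
  case less
  let ?C = "{c \<in> {v<..r}. f c = v}" and ?h = "hook (father_graph r f)"
  have fin: "finite (?h c)" if "c \<in> ?C" for c
    using that less.prems by (intro finite_hook_father_graph) auto
  have notin: "v \<notin> ?h c" if "c \<in> ?C" for c
  proof
    assume "v \<in> ?h c"
    then have "(c, v) \<in> (son_rel (father_graph r f))\<^sup>*"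
      by (auto simp: hook_def descendants_def)
    then have "c \<le> v" by (rule son_rel_father_graph_rtrancl_le)
    then show False using that by simp
  qed
  have "sum y (?h v) = y v + sum y (\<Union>c\<in>?C. ?h c)"
    unfolding hook_father_graph_rec[OF less.prems] using fin notin by (subst sum.insert) auto
  also have "sum y (\<Union>c\<in>?C. ?h c) = (\<Sum>c\<in>?C. sum y (?h c))"
    using fin less.prems by (intro sum.UNION_disjoint ballI impI hook_father_graph_disjoint) auto
  also have "\<dots> = (\<Sum>c\<in>?C. hook_sum r y f c)"
    using less.prems by (intro sum.cong refl less.hyps) auto
  also have "y v + \<dots> = hook_sum r y f v"
    by (rule hook_sum.simps[symmetric])
  finally show ?case .
qed

lemma wt_father_graph: "wt r k (father_graph r f) = forest_weight r k 1 f"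
proof -
  have *: "{2..r} = {1<..r}" by auto
  show ?thesis
    unfolding wt_def forest_weight_def *
  proof (rule prod.cong[OF refl])
    fix v assume v: "v \<in> {1<..r}"
    \<comment> \<open>Summing \<open>k u - 1\<close> over the hook subtracts its
      cardinality.\<close>
    have "hook_sum r (\<lambda>u. k u - 1) f v
        = (\<Sum>u\<in>hook (father_graph r f) v. k u) - of_nat (card (hook (father_graph r f) v))"
      using v by (subst sum_hook_father_graph[symmetric]) (auto simp: sum_subtractf)
    then show "k (father (father_graph r f) v) * ((\<Sum>u\<in>hook (father_graph r f) v. k u) -
          of_nat (card (hook (father_graph r f) v)) + 1)
        = k (f v) * (hook_sum r (\<lambda>u. k u - 1) f v + 1)"
      using father_father_graph[OF v] by simp
  qed
qed

end

text \<open>Choosing a father for every vertex but the root gives a spanning tree inside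
  \<open>T\<close>; since \<open>T\<close> has no cycles, it has no further edges.\<close>

lemma increasing_tree_is_father_graph:
  assumes r: "1 \<le> r" and T: "T \<in> increasing_trees r"
  shows "T \<in> father_graph r ` forests r 1"
proof -
  have wf: "wf_graph T" and conn: "connected_graph T" and acyc: "\<And>vs. \<not> is_cycle T vs"
    and verts: "verts T = {1..r}" and incr: "\<And>u v. (u, v) \<in> son_rel T \<Longrightarrow> u < v"
    using T by (auto simp: increasing_trees_def rooted_tree_def)
  have edge: "e \<subseteq> {1..r}" "card e = 2" if "e \<in> edges T" for e
    using wf that verts by (auto simp: wf_graph_def)
  have son_edge: "{u, v} \<in> edges T" if "(u, v) \<in> son_rel T" for u v
    using that by (simp add: son_rel_def)
  have pred: "\<exists>u. (u, v) \<in> son_rel T" if "v \<in> {1..r}" "v \<noteq> root T" for v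
    using exists_son_rel_pred[OF wf conn] that verts by auto
  \<comment> \<open>A vertex other than the root has a father with a smaller label, which
    \<open>1\<close> cannot have.\<close>
  have root: "root T = 1"
  proof (rule ccontr)
    assume "root T \<noteq> 1"
    then obtain u where u: "(u, 1) \<in> son_rel T" using pred[of 1] r by auto
    then show False using incr[OF u] edge(1)[OF son_edge[OF u]] by auto
  qed
  \<comment> \<open>\<open>restrict\<close> makes \<open>f\<close> extensional, as membership in
    \<open>forests r 1\<close> demands.\<close>
  define f where "f = restrict (\<lambda>v. SOME u. (u, v) \<in> son_rel T) {1<..r}"
  have fv: "(f v, v) \<in> son_rel T" if "v \<in> {1<..r}" for v
    using pred[of v] that root by (auto simp: f_def intro: someI)
  have f: "1 \<le> f v \<and> f v < v" if "v \<in> {1<..r}" for v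
    using incr[OF fv[OF that]] edge(1)[OF son_edge[OF fv[OF that]]] by auto
  let ?G = "father_graph r f"
  have sub: "edges ?G \<subseteq> edges T" using fv son_edge by auto
  \<comment> \<open>A path in the spanning tree joining the ends of an additional edge closes up to a cycle.\<close>
  moreover have "edges T \<subseteq> edges ?G"
  proof (rule ccontr)
    assume "\<not> edges T \<subseteq> edges ?G"
    then obtain e where e: "e \<in> edges T" "e \<notin> edges ?G" by auto
    then obtain a b where ab: "e = {a, b}" "a \<noteq> b" using edge(2)[OF e(1)] by (auto simp: card_2_iff)
    have "connected_graph ?G"
      using rooted_tree_father_graph[OF r f] by (simp add: rooted_tree_def)
    then have "(a, b) \<in> (adj ?G)\<^sup>*"
      using edge(1)[OF e(1)] ab by (simp add: connected_graph_def)
    then obtain xs where xs: "xs \<noteq> []" "hd xs = a" "last xs = b" "distinct xs"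
        "\<And>i. Suc i < length xs \<Longrightarrow> {xs ! i, xs ! Suc i} \<in> edges ?G"
      using rtrancl_imp_distinct_path[of a b "adj ?G"] unfolding adj_def by auto
    have ends: "xs ! 0 = a" "xs ! (length xs - 1) = b"
      using xs by (simp_all add: hd_conv_nth last_conv_nth)
    \<comment> \<open>One vertex would give \<open>a = b\<close>; two would make \<open>e\<close> an
      edge of \<open>?G\<close>.\<close>
    have "length xs \<noteq> 1" using ends ab by auto
    moreover have "length xs \<noteq> 2" using ends xs(5)[of 0] e ab by auto
    ultimately have len: "length xs \<ge> 3" using xs(1) by (cases "length xs") auto
    have "{xs ! i, xs ! (Suc i mod length xs)} \<in> edges T" if "i < length xs" for i
    proof (cases "Suc i = length xs")
      case True
      then have "i = length xs - 1" by simp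
      then show ?thesis using True e ab ends by (simp add: insert_commute)
    next
      case False
      then have "Suc i < length xs" using that by simp
      then show ?thesis using xs(5)[of i] sub by auto
    qed
    then have "is_cycle T xs" using len xs(4) by (simp add: is_cycle_def)
    then show False using acyc by simp
  qed
  ultimately have "T = ?G"
    using verts root by (intro rooted_graph.equality) auto
  moreover have "f \<in> forests r 1"
    unfolding forests_def using f by (auto simp: f_def)
  ultimately show ?thesis by blast
qed

text \<open>\<open>father_graph r\<close> is a bijection from \<open>forests r 1\<close> to the
  increasing trees: \<open>father\<close> recovers \<open>f\<close> on \<open>{1<..r}\<close>, and
  extensionality fixes the rest.\<close>

lemma sum_increasing_trees:
  assumes r: "1 \<le> r"
  shows "(\<Sum>T\<in>increasing_trees r. wt r k T) = (\<Sum>f\<in>forests r 1. forest_weight r k 1 f)"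
proof -
  have f: "1 \<le> f v \<and> f v < v" if "f \<in> forests r 1" "v \<in> {1<..r}" for f v
    using PiE_mem[OF that(1)[unfolded forests_def] that(2)] by simp
  have inj: "inj_on (father_graph r) (forests r 1)"
  proof (rule inj_onI)
    fix f g assume fg: "f \<in> forests r 1" "g \<in> forests r 1" "father_graph r f = father_graph r g"
    have "f v = g v" if "v \<in> {1<..r}" for v
      using father_father_graph[OF r f[OF fg(1)] that] father_father_graph[OF r f[OF fg(2)] that] fg(3)
      by simp
    then show "f = g"
      using fg(1,2) unfolding forests_def by (rule PiE_ext[rotated 2])
  qed
  have "increasing_trees r = father_graph r ` forests r 1"
  proof (intro equalityI subsetI)
    fix T assume "T \<in> father_graph r ` forests r 1"
    then obtain g where "g \<in> forests r 1" "T = father_graph r g" by auto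
    then show "T \<in> increasing_trees r" using father_graph_increasing[OF r f] by simp
  qed (rule increasing_tree_is_father_graph[OF r])
  then have "(\<Sum>T\<in>increasing_trees r. wt r k T) = (\<Sum>f\<in>forests r 1. wt r k (father_graph r f))"
    using sum.reindex[OF inj] by simp
  also have "\<dots> = (\<Sum>f\<in>forests r 1. forest_weight r k 1 f)"
    using wt_father_graph[OF r f] by (intro sum.cong) auto
  finally show ?thesis .
qed

section \<open>The variables and the falling factorial\<close>

text \<open>The coefficient of the variable with index \<open>1\<close> is \<open>1\<close>. This
  supplies the nonvanishing for the cancellations.\<close>

lemma sum_fvar_nonzero:
  assumes "1 \<le> m"
  shows "(\<Sum>i=1..m. fvar i :: 'a::idom ratfun) \<noteq> 0"
proof -
  let ?X = "\<lambda>i. Poly_Mapping.single (Poly_Mapping.single i 1) 1 :: (nat \<Rightarrow>\<^sub>0 nat) \<Rightarrow>\<^sub>0 'a"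
  have sum: "(\<Sum>i\<in>A. fvar i :: 'a ratfun) = Fract (\<Sum>i\<in>A. ?X i) 1" if "finite A" for A
    using that by (induction A) (auto simp: fvar_def Zero_fract_def)
  have "Poly_Mapping.single i 1 = Poly_Mapping.single (1::nat) (1::nat) \<longleftrightarrow> i = 1" for i
    by (metis lookup_single_eq lookup_single_not_eq zero_neq_one)
  then have "Poly_Mapping.lookup (\<Sum>i=1..m. ?X i) (Poly_Mapping.single 1 1) = (\<Sum>i=1..m. if i = 1 then 1 else 0)"
    by (auto simp: lookup_sum lookup_single when_def intro!: sum.cong)
  also have "\<dots> = 1" using assms by simp
  finally have "(\<Sum>i=1..m. ?X i) \<noteq> 0" by auto
  then show ?thesis unfolding sum[OF finite_atLeastAtMost] by (simp add: eq_fract Zero_fract_def)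
qed

lemma ffact_nat_Suc_left: "ffact_nat a (Suc n) = a * ffact_nat (a - 1) n"
  unfolding ffact_nat_def by (subst prod.lessThan_Suc_shift) (simp add: diff_diff_eq)

theorem theorem1p1:
  fixes r :: nat
    and k :: "nat \<Rightarrow> 'a::{idom, ring_char_0} ratfun"
    and K :: "'a ratfun"
  assumes "r \<ge> 1"
    and "k = fvar"
    and "K = (\<Sum>i=1..r. k i)"
  shows "(\<Sum>T\<in>increasing_trees r. wt r k T) = (\<Prod>i=1..r. k i) * ffact (K - 1) (int r - 2)"
proof -
  have K: "K \<noteq> 0" using assms sum_fvar_nonzero by simp
  have "{1..r} = insert 1 {1<..r}" using assms(1) by auto
  then have "(\<Prod>i=1..r. k i) = k 1 * (\<Prod>i\<in>{1<..r}. k i)" by simp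
  \<comment> \<open>At \<open>j = 1\<close> the partial sum is \<open>k 1\<close>, the factor
    missing from the product over \<open>{1<..r}\<close>.\<close>
  then have "K * (\<Sum>T\<in>increasing_trees r. wt r k T) = (\<Prod>i=1..r. k i) * ffact_nat K (r - 1)"
    unfolding sum_increasing_trees[OF assms(1)] assms(3)
    using assms(1) sum_fvar_nonzero by (subst sum_forest_weight) (simp_all add: assms(2))
  \<comment> \<open>Splitting off the first factor \<open>K\<close> leaves order
    \<open>r - 2\<close>. For \<open>r = 1\<close> this order is \<open>-1\<close>, and
    \<open>ffact (K - 1) (-1) = 1 / K\<close> with \<open>K \<noteq> 0\<close>.\<close>
  also have "ffact_nat K (r - 1) = K * ffact (K - 1) (int r - 2)"
  proof (cases "r = 1")
    case True
    then show ?thesis using K by (simp add: ffact_def ffact_nat_def)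
  next
    case False
    then have "r = Suc (Suc (r - 2))" using assms(1) by simp
    then obtain n where "r = Suc (Suc n)" ..
    then show ?thesis by (simp add: ffact_def ffact_nat_Suc_left)
  qed
  finally have "K * (\<Sum>T\<in>increasing_trees r. wt r k T) =
      K * ((\<Prod>i=1..r. k i) * ffact (K - 1) (int r - 2))"
    by (simp only: mult.left_commute)
  then show ?thesis by (simp only: mult_left_cancel[OF K])
qed

end
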